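(* Let $f(x)=\sum_{i=1}^n x_i^2+a\sum_{i=1}^n x_i+b\sum_{i<j}x_ix_j$ with $a,b\in\mathbb{R}$, where $n\ge 2$ is the number of variables. Then: (1) If $b>2$ or $b<\frac{-2}{n-1}$, then $f^*=f^{\mathrm{SONC}}=-\infty$. (2) If $\frac{-2}{n-1}\le b\le 0$, then $f^*=f^{\mathrm{SONC}}=\frac{-a^2n}{4+2b(n-1)}$. (3) If $0\le b\le\frac{2}{n-1}$, then $f^*=\frac{-a^2n}{4+2b(n-1)}$ and $f^{\mathrm{SONC}}=\frac{-a^2n}{4-2b(n-1)}$. (4) If $\frac{2}{n-1}<b\le 2$, then $f^*=\frac{-a^2n}{4+2b(n-1)}$ and $f^{\mathrm{SONC}}=-\infty$.
   Context: For a finite set $\mathcal{A}\subset\mathbb{N}^n$ and $\beta\in\mathbb{N}^n\setminus\mathcal{A}$ (with $0\in\mathbb{N}$), $C_{\mathrm{AG}}(\mathcal{A},\beta)$ is the set of polynomials $\sum_{\alpha\in\mathcal{A}}c_\alpha x^\alpha+c_\beta x^\beta$ with $c_\alpha\ge 0$ for $\alpha\in\mathcal{A}$, $c_\beta\in\mathbb{R}$, $c_\gamma=0$ for all $\gamma\in\mathcal{A}\setminus(2\mathbb{N})^n$, that are nonnegative on $\mathbb{R}^n$. For a nonempty finite set $\mathcal{T}\subset\mathbb{N}^n$, $C_{\mathrm{SONC}}(\mathcal{T})=\sum_{\beta\in\mathcal{T}}C_{\mathrm{AG}}(\mathcal{T}\setminus\{\beta\},\beta)$ (Minkowski sum). For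 a polynomial $f$, $f^*=\inf_{x\in\mathbb{R}^n}f(x)$ and $f^{\mathrm{SONC}}=\sup\{\lambda\in\mathbb{R}: f-\lambda\in C_{\mathrm{SONC}}(\mathcal{T})\}$, where $\mathcal{T}$ is the set of exponents occurring in $f$ together with $0$; the supremum of the empty set is $-\infty$. *)

theory Defs
  imports "HOL-Analysis.Analysis" "HOL-Library.Poly_Mapping" "HOL-Library.Set_Algebras"
begin

text \<open>
  Real polynomials in the variables indexed by \<open>'n\<close>: finitely supported maps from exponent
  vectors (elements of \<open>nat^'n\<close>) to coefficients, with the convolution product.
\<close>

type_synonym 'n mpoly = "(nat, 'n) vec \<Rightarrow>\<^sub>0 real"

definition monom_val :: "nat ^ 'n \<Rightarrow> real ^ 'n \<Rightarrow> real" where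
  "monom_val \<alpha> x = (\<Prod>i\<in>UNIV. (x $ i) ^ (\<alpha> $ i))"

definition mpoly_eval :: "'n::finite mpoly \<Rightarrow> real ^ 'n \<Rightarrow> real" where
  "mpoly_eval p x = (\<Sum>\<alpha>\<in>Poly_Mapping.keys p. Poly_Mapping.lookup p \<alpha> * monom_val \<alpha> x)"

definition mpoly_const :: "real \<Rightarrow> 'n::finite mpoly" where
  "mpoly_const c = Poly_Mapping.single 0 c"

definition mpoly_var :: "'n::finite \<Rightarrow> 'n mpoly" where
  "mpoly_var i = Poly_Mapping.single (axis i 1) 1"

definition even_exponents :: "(nat ^ 'n) set" where
  "even_exponents = {\<alpha>. \<forall>i. even (\<alpha> $ i)}"

text \<open>Only meaningful for finite \<open>A\<close> and \<open>\<beta> \<notin> A\<close>.\<close>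

definition C_AG :: "(nat ^ 'n) set \<Rightarrow> nat ^ 'n \<Rightarrow> 'n::finite mpoly set" where
  "C_AG A \<beta> = {p. (\<exists>(c :: nat ^ 'n \<Rightarrow> real) c\<^sub>\<beta>.
      p = (\<Sum>\<alpha>\<in>A. Poly_Mapping.single \<alpha> (c \<alpha>)) + Poly_Mapping.single \<beta> c\<^sub>\<beta>
      \<and> (\<forall>\<alpha>\<in>A. c \<alpha> \<ge> 0)
      \<and> (\<forall>\<gamma>\<in>A - even_exponents. c \<gamma> = 0))
    \<and> (\<forall>x. mpoly_eval p x \<ge> 0)}"

text \<open>The sum below is a sum of sets in the sense of \<open>Set_Algebras\<close>, i.e. a Minkowski sum.\<close>

definition C_SONC :: "(nat ^ 'n) set \<Rightarrow> 'n::finite mpoly set" where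
  "C_SONC T = (\<Sum>\<beta>\<in>T. C_AG (T - {\<beta>}) \<beta>)"

definition poly_inf :: "'n::finite mpoly \<Rightarrow> ereal" where
  "poly_inf f = (INF x. ereal (mpoly_eval f x))"

text \<open>In \<open>ereal\<close> the supremum of the empty set is \<open>-\<infinity>\<close>.\<close>

definition poly_SONC :: "'n::finite mpoly \<Rightarrow> ereal" where
  "poly_SONC f =
    Sup (ereal ` {l. f - mpoly_const l \<in> C_SONC (insert 0 (Poly_Mapping.keys f))})"

text \<open>
  Infima and suprema are compared with quotients formed in \<open>ereal\<close>. There a negative number
  divided by \<open>0\<close> is \<open>-\<infinity>\<close> while \<open>0 / 0 = 0\<close>, which is the value intended when the
  denominator vanishes at an endpoint of a range of parameters.
\<close>

end

theory Submission
  imports Defs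
begin

text \<open>
  The proof rests on one identity, valid for all real \<open>a\<close> and \<open>b\<close>: the SONC bound of
  \<open>f\<close> is the infimum of the function obtained from \<open>f\<close> by replacing \<open>b\<close> with
  \<open>- \<bar>b\<bar>\<close> (lemma \<open>poly_SONC_symmetric_poly\<close>). All four cases then follow from the
  infimum of \<open>\<Sum>x\<^sub>i\<^sup>2 + a \<Sum>x\<^sub>i + b \<Sum>x\<^sub>i x\<^sub>j\<close> as a function of \<open>b\<close>.

  The SONC bound cannot be larger because each summand of a SONC polynomial has at most
  one monomial that is not an even one. Flipping the sign of one variable that occurs in that
  monomial with odd exponent flips the sign of its coefficient and leaves the rest of the
  summand alone. Hence a SONC polynomial stays nonnegative when the signs of its odd
  monomials are changed arbitrarily and independently of each other
  (\<open>C_SONC_sign_twist_nonneg\<close>); in particular all products \<open>x\<^sub>i x\<^sub>j\<close> may be given the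
  coefficient \<open>- \<bar>b\<bar>\<close>.

  The bound is reached by an explicit decomposition. If \<open>2 c = 2 - \<bar>b\<bar> (n - 1)\<close>
  and \<open>c > 0\<close>, then
  \<open>f + n a\<^sup>2 / (4 c) = \<Sum> c (x\<^sub>i + a / (2 c))\<^sup>2 + \<Sum> \<bar>b\<bar> / 2 (x\<^sub>i \<plusminus> x\<^sub>j)\<^sup>2\<close>, where the second sum is over
  \<open>i < j\<close> and the sign is that of \<open>b\<close>. Each square has two even monomials and one mixed
  term, so it lies in the SONC cone (\<open>square_in_C_SONC\<close>).

  For the infimum, let \<open>S\<close> and \<open>s\<close> be the sums of the \<open>x\<^sub>i\<^sup>2\<close> and of the \<open>x\<^sub>i\<close>. The function
  equals \<open>(1 - b / 2) (S - s\<^sup>2 / n) + (2 + b (n - 1)) s\<^sup>2 / (2 n) + a s\<close>. The first term is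
  nonnegative for \<open>b \<le> 2\<close> by the Cauchy-Schwarz inequality and vanishes on the diagonal, where
  a univariate quadratic remains; for \<open>b > 2\<close> the function is unbounded below along
  \<open>x\<^sub>i = - x\<^sub>j\<close>.
\<close>

section \<open>Evaluating polynomials with arbitrary monomial weights\<close>

text \<open>
  Letting the weights be arbitrary, rather than the values of the monomials at a point,
  covers at the same time evaluation, evaluation with signs changed, and extraction of a
  coefficient (a weight supported at one exponent). A single computation for the polynomial
  of the theorem then yields all three.
\<close>

definition weighted_eval :: "(nat ^ 'n \<Rightarrow> real) \<Rightarrow> 'n::finite mpoly \<Rightarrow> real" where
  "weighted_eval w p = (\<Sum>\<alpha>\<in>Poly_Mapping.keys p. Poly_Mapping.lookup p \<alpha> * w \<alpha>)"

lemma mpoly_eval_eq_weighted_eval: "mpoly_eval p x = weighted_eval (\<lambda>\<alpha>. monom_val \<alpha> x) p"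
  by (simp add: mpoly_eval_def weighted_eval_def)

lemma weighted_eval_superset:
  assumes "finite S" "Poly_Mapping.keys p \<subseteq> S"
  shows "weighted_eval w p = (\<Sum>\<alpha>\<in>S. Poly_Mapping.lookup p \<alpha> * w \<alpha>)"
  unfolding weighted_eval_def using assms
  by (intro sum.mono_neutral_left) (auto simp: in_keys_iff)

lemma weighted_eval_zero [simp]: "weighted_eval w 0 = 0"
  by (simp add: weighted_eval_def)

lemma weighted_eval_single [simp]: "weighted_eval w (Poly_Mapping.single \<alpha> c) = c * w \<alpha>"
  by (simp add: weighted_eval_def)

lemma weighted_eval_add [simp]: "weighted_eval w (p + q) = weighted_eval w p + weighted_eval w q"
proof -
  let ?S = "Poly_Mapping.keys p \<union> Poly_Mapping.keys q"
  have "Poly_Mapping.keys (p + q) \<subseteq> ?S"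
    by (rule Poly_Mapping.keys_add)
  then show ?thesis
    by (simp add: weighted_eval_superset[of ?S] lookup_add distrib_right sum.distrib)
qed

lemma weighted_eval_diff [simp]: "weighted_eval w (p - q) = weighted_eval w p - weighted_eval w q"
  using weighted_eval_add[of w "p - q" q] by simp

lemma weighted_eval_sum [simp]: "weighted_eval w (\<Sum>i\<in>I. p i) = (\<Sum>i\<in>I. weighted_eval w (p i))"
  by (induction I rule: infinite_finite_induct) auto

lemma lookup_eq_weighted_eval:
  "Poly_Mapping.lookup p \<gamma> = weighted_eval (\<lambda>\<alpha>. if \<alpha> = \<gamma> then 1 else 0) p"
  by (auto simp: weighted_eval_def if_distrib[of "(*) _"] in_keys_iff cong: if_cong)

lemma poly_mapping_eqI_weighted_eval:
  assumes "\<And>w. weighted_eval w p = weighted_eval w q"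
  shows "p = q"
  by (rule poly_mapping_eqI) (simp add: lookup_eq_weighted_eval assms)

lemma monom_val_add: "monom_val (\<alpha> + \<beta>) x = monom_val \<alpha> x * monom_val \<beta> x"
  by (simp add: monom_val_def power_add prod.distrib)

lemma monom_val_zero [simp]: "monom_val 0 x = 1"
  by (simp add: monom_val_def)

lemma monom_val_unit: "monom_val (axis i 1) x = x $ i"
proof -
  have "monom_val (axis i 1) x = (\<Prod>j\<in>UNIV. if j = i then x $ i else 1)"
    unfolding monom_val_def by (intro prod.cong) (auto simp: axis_def)
  then show ?thesis by simp
qed

section \<open>The SONC cone\<close>

lemma zero_in_C_AG: "0 \<in> C_AG A \<beta>"
  unfolding C_AG_def mpoly_eval_eq_weighted_eval
  by (auto intro!: exI[of _ "\<lambda>_. 0"] exI[of _ 0])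

lemma C_AG_add:
  assumes "p \<in> C_AG A \<beta>" "q \<in> C_AG A \<beta>"
  shows "p + q \<in> C_AG A \<beta>"
proof -
  obtain c d where p: "p = (\<Sum>\<alpha>\<in>A. Poly_Mapping.single \<alpha> (c \<alpha>)) + Poly_Mapping.single \<beta> d"
    "\<forall>\<alpha>\<in>A. c \<alpha> \<ge> 0" "\<forall>\<gamma>\<in>A - even_exponents. c \<gamma> = 0" "\<forall>x. mpoly_eval p x \<ge> 0"
    using assms(1) unfolding C_AG_def by blast
  obtain c' d' where q: "q = (\<Sum>\<alpha>\<in>A. Poly_Mapping.single \<alpha> (c' \<alpha>)) + Poly_Mapping.single \<beta> d'"
    "\<forall>\<alpha>\<in>A. c' \<alpha> \<ge> 0" "\<forall>\<gamma>\<in>A - even_exponents. c' \<gamma> = 0" "\<forall>x. mpoly_eval q x \<ge> 0"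
    using assms(2) unfolding C_AG_def by blast
  have "p + q = (\<Sum>\<alpha>\<in>A. Poly_Mapping.single \<alpha> (c \<alpha> + c' \<alpha>)) + Poly_Mapping.single \<beta> (d + d')"
    using p(1) q(1) by (simp add: single_add sum.distrib algebra_simps)
  moreover have "\<forall>x. mpoly_eval (p + q) x \<ge> 0"
    using p(4) q(4) by (simp add: mpoly_eval_eq_weighted_eval)
  ultimately show ?thesis
    unfolding C_AG_def using p(2,3) q(2,3)
    by (intro CollectI conjI exI[of _ "\<lambda>\<alpha>. c \<alpha> + c' \<alpha>"] exI[of _ "d + d'"]) auto
qed

lemma C_SONC_iff:
  assumes "finite T"
  shows "p \<in> C_SONC T \<longleftrightarrow> (\<exists>g. p = (\<Sum>\<beta>\<in>T. g \<beta>) \<and> (\<forall>\<beta>\<in>T. g \<beta> \<in> C_AG (T - {\<beta>}) \<beta>))"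
  unfolding C_SONC_def set_sum_alt[OF assms] by blast

lemma C_SONC_add:
  assumes "finite T" "p \<in> C_SONC T" "q \<in> C_SONC T"
  shows "p + q \<in> C_SONC T"
proof -
  obtain g h where "p = (\<Sum>\<beta>\<in>T. g \<beta>)" "\<forall>\<beta>\<in>T. g \<beta> \<in> C_AG (T - {\<beta>}) \<beta>"
    and "q = (\<Sum>\<beta>\<in>T. h \<beta>)" "\<forall>\<beta>\<in>T. h \<beta> \<in> C_AG (T - {\<beta>}) \<beta>"
    using assms by (auto simp: C_SONC_iff)
  then show ?thesis
    unfolding C_SONC_iff[OF assms(1)]
    by (intro exI[of _ "\<lambda>\<beta>. g \<beta> + h \<beta>"]) (auto simp: sum.distrib C_AG_add)
qed

lemma C_AG_subset_C_SONC:
  assumes "finite T" "\<beta> \<in> T" "p \<in> C_AG (T - {\<beta>}) \<beta>"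
  shows "p \<in> C_SONC T"
  unfolding C_SONC_iff[OF assms(1)] using assms
  by (intro exI[of _ "\<lambda>\<gamma>. if \<gamma> = \<beta> then p else 0"]) (auto simp: zero_in_C_AG)

lemma zero_in_C_SONC: "finite T \<Longrightarrow> 0 \<in> C_SONC T"
  unfolding C_SONC_iff by (intro exI[of _ "\<lambda>_. 0"]) (auto simp: zero_in_C_AG)

lemma C_SONC_sum:
  assumes "finite T" "\<And>i. i \<in> I \<Longrightarrow> p i \<in> C_SONC T"
  shows "(\<Sum>i\<in>I. p i) \<in> C_SONC T"
  using assms(2)
  by (induction I rule: infinite_finite_induct) (auto simp: zero_in_C_SONC C_SONC_add assms(1))

lemma double_in_even_exponents: "\<alpha> + \<alpha> \<in> even_exponents"
  by (simp add: even_exponents_def)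

lemma even_monomial_in_C_SONC:
  assumes "finite T" "\<alpha> + \<alpha> \<in> T" "s \<ge> 0"
  shows "Poly_Mapping.single (\<alpha> + \<alpha>) s \<in> C_SONC T"
proof (rule C_AG_subset_C_SONC[OF assms(1,2)])
  show "Poly_Mapping.single (\<alpha> + \<alpha>) s \<in> C_AG (T - {\<alpha> + \<alpha>}) (\<alpha> + \<alpha>)"
    unfolding C_AG_def mpoly_eval_eq_weighted_eval using assms(3)
    by (auto simp: monom_val_add intro!: exI[of _ "\<lambda>_. 0"])
qed

lemma binary_quadratic_nonneg:
  fixes r s t u v :: real
  assumes "s \<ge> 0" "t \<ge> 0" "r\<^sup>2 \<le> 4 * s * t"
  shows "s * (u * u) + t * (v * v) + r * (u * v) \<ge> 0"
proof -
  have "\<bar>r\<bar> \<le> 2 * (sqrt s * sqrt t)"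
  proof (rule power2_le_imp_le)
    show "\<bar>r\<bar>\<^sup>2 \<le> (2 * (sqrt s * sqrt t))\<^sup>2"
      using assms by (simp add: power_mult_distrib)
  qed (use assms in auto)
  then have "\<bar>r * (u * v)\<bar> \<le> 2 * (sqrt s * sqrt t) * \<bar>u * v\<bar>"
    unfolding abs_mult[of r] by (intro mult_right_mono) auto
  moreover have "0 \<le> (sqrt s * \<bar>u\<bar> - sqrt t * \<bar>v\<bar>)\<^sup>2"
    by simp
  then have "2 * (sqrt s * sqrt t) * \<bar>u * v\<bar> \<le> s * (u * u) + t * (v * v)"
    using assms by (simp add: power2_diff abs_mult algebra_simps
        power2_eq_square[of u] power2_eq_square[of v])
  ultimately show ?thesis by linarith
qed

text \<open>
  The conditions on the coefficients make the form \<open>s u\<^sup>2 + t v\<^sup>2 + r u v\<close> positive semidefinite. The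
  mixed exponent serves as the one that may carry a coefficient of either sign; it differs
  from the two even ones because \<open>\<alpha> \<noteq> \<beta>\<close>. For \<open>r = 0\<close> it may be absent from \<open>T\<close>,
  which happens for the theorem's polynomial when \<open>a\<close> or \<open>b\<close> vanishes.
\<close>

lemma square_in_C_SONC:
  assumes fin: "finite T" and mem: "\<alpha> + \<alpha> \<in> T" "\<beta> + \<beta> \<in> T" "r \<noteq> 0 \<Longrightarrow> \<alpha> + \<beta> \<in> T"
    and ne: "\<alpha> \<noteq> \<beta>" and coeff: "s \<ge> 0" "t \<ge> 0" "r\<^sup>2 \<le> 4 * s * t"
  shows "Poly_Mapping.single (\<alpha> + \<alpha>) s + Poly_Mapping.single (\<beta> + \<beta>) t
           + Poly_Mapping.single (\<alpha> + \<beta>) r \<in> C_SONC T" (is "?p \<in> _")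
proof (cases "r = 0")
  case True
  then show ?thesis
    using even_monomial_in_C_SONC[OF fin mem(1) coeff(1)] even_monomial_in_C_SONC[OF fin mem(2) coeff(2)]
    by (simp add: C_SONC_add[OF fin])
next
  case False
  let ?A = "T - {\<alpha> + \<beta>}"
  define c where "c \<gamma> = (if \<gamma> = \<alpha> + \<alpha> then s else 0) + (if \<gamma> = \<beta> + \<beta> then t else 0)" for \<gamma>
  have A: "\<alpha> + \<alpha> \<in> ?A" "\<beta> + \<beta> \<in> ?A"
    using mem ne by auto
  have split: "Poly_Mapping.single \<gamma> (c \<gamma>) =
      (if \<gamma> = \<alpha> + \<alpha> then Poly_Mapping.single (\<alpha> + \<alpha>) s else 0)
      + (if \<gamma> = \<beta> + \<beta> then Poly_Mapping.single (\<beta> + \<beta>) t else 0)" for \<gamma>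
    by (auto simp: c_def single_add)
  have "?p = (\<Sum>\<gamma>\<in>?A. Poly_Mapping.single \<gamma> (c \<gamma>)) + Poly_Mapping.single (\<alpha> + \<beta>) r"
    using A fin by (simp add: split sum.distrib)
  moreover have "\<forall>\<gamma>\<in>?A. c \<gamma> \<ge> 0"
    using coeff by (simp add: c_def)
  moreover have "\<forall>\<gamma>\<in>?A - even_exponents. c \<gamma> = 0"
    using double_in_even_exponents by (auto simp: c_def)
  moreover have "\<forall>x. mpoly_eval ?p x \<ge> 0"
    using binary_quadratic_nonneg[OF coeff]
    by (simp add: mpoly_eval_eq_weighted_eval monom_val_add)
  ultimately have "?p \<in> C_AG ?A (\<alpha> + \<beta>)"
    unfolding C_AG_def by blast
  then show ?thesis
    using C_AG_subset_C_SONC[OF fin] mem(3) False by blast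
qed

text \<open>
  Only \<open>\<beta>\<close> can be an odd exponent with a nonzero coefficient. If its sign is to be changed,
  reflecting a coordinate in which \<open>\<beta>\<close> is odd does so and preserves all even monomials; the
  twisted value is thus the value of \<open>p\<close> at another point.
\<close>

lemma C_AG_sign_twist_nonneg:
  fixes \<epsilon> :: "nat ^ 'n::finite \<Rightarrow> real"
  assumes p: "p \<in> C_AG A \<beta>"
    and sign: "\<epsilon> \<beta> = 1 \<or> \<epsilon> \<beta> = -1" and even: "\<And>\<alpha>. \<alpha> \<in> even_exponents \<Longrightarrow> \<epsilon> \<alpha> = 1"
  shows "weighted_eval (\<lambda>\<alpha>. \<epsilon> \<alpha> * monom_val \<alpha> x) p \<ge> 0"
proof -
  obtain c d where peq: "p = (\<Sum>\<alpha>\<in>A. Poly_Mapping.single \<alpha> (c \<alpha>)) + Poly_Mapping.single \<beta> d"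
    and odd0: "\<forall>\<gamma>\<in>A - even_exponents. c \<gamma> = 0" and nonneg: "\<forall>x. mpoly_eval p x \<ge> 0"
    using p unfolding C_AG_def by blast
  obtain y where yb: "monom_val \<beta> y = \<epsilon> \<beta> * monom_val \<beta> x"
    and ya: "\<And>\<alpha>. \<alpha> \<in> even_exponents \<Longrightarrow> monom_val \<alpha> y = monom_val \<alpha> x"
  proof (cases "\<epsilon> \<beta> = 1")
    case True
    then show ?thesis using that[of x] by simp
  next
    case False
    then have "\<beta> \<notin> even_exponents" and eb: "\<epsilon> \<beta> = -1"
      using even sign by auto
    then obtain i where i: "odd (\<beta> $ i)"
      by (auto simp: even_exponents_def)
    define y where "y = (\<chi> j. if j = i then - x $ i else x $ j)"
    have flip: "monom_val \<alpha> y = (-1) ^ (\<alpha> $ i) * monom_val \<alpha> x" for \<alpha>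
    proof -
      have "monom_val \<alpha> y = (\<Prod>j\<in>UNIV. (if j = i then (-1) ^ (\<alpha> $ i) else 1) * x $ j ^ (\<alpha> $ j))"
        unfolding monom_val_def y_def by (intro prod.cong) (auto simp: power_minus[of "x $ i"])
      then show ?thesis by (simp add: prod.distrib monom_val_def)
    qed
    show ?thesis
      using i eb by (intro that[of y]) (auto simp: flip even_exponents_def)
  qed
  have "(\<Sum>\<alpha>\<in>A. c \<alpha> * (\<epsilon> \<alpha> * monom_val \<alpha> x)) = (\<Sum>\<alpha>\<in>A. c \<alpha> * monom_val \<alpha> y)"
  proof (rule sum.cong)
    show "c \<alpha> * (\<epsilon> \<alpha> * monom_val \<alpha> x) = c \<alpha> * monom_val \<alpha> y" if "\<alpha> \<in> A" for \<alpha>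
      using odd0 that by (cases "\<alpha> \<in> even_exponents") (auto simp: even ya)
  qed simp
  then have "weighted_eval (\<lambda>\<alpha>. \<epsilon> \<alpha> * monom_val \<alpha> x) p = mpoly_eval p y"
    by (simp add: peq mpoly_eval_eq_weighted_eval yb)
  with nonneg show ?thesis by simp
qed

text \<open>
  The reflected point may be chosen separately for each summand, so one sign pattern can
  be imposed on all odd monomials even if no single point realises it.
\<close>

lemma C_SONC_sign_twist_nonneg:
  fixes \<epsilon> :: "nat ^ 'n::finite \<Rightarrow> real"
  assumes "finite T" "p \<in> C_SONC T"
    and "\<And>\<alpha>. \<epsilon> \<alpha> = 1 \<or> \<epsilon> \<alpha> = -1" "\<And>\<alpha>. \<alpha> \<in> even_exponents \<Longrightarrow> \<epsilon> \<alpha> = 1"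
  shows "weighted_eval (\<lambda>\<alpha>. \<epsilon> \<alpha> * monom_val \<alpha> x) p \<ge> 0"
proof -
  obtain g where p: "p = (\<Sum>\<beta>\<in>T. g \<beta>)" and g: "\<forall>\<beta>\<in>T. g \<beta> \<in> C_AG (T - {\<beta>}) \<beta>"
    using assms(1,2) by (auto simp: C_SONC_iff)
  show ?thesis
    unfolding p weighted_eval_sum
    by (intro sum_nonneg C_AG_sign_twist_nonneg[OF bspec[OF g]] assms(3,4))
qed

section \<open>The infimum of the quadratic function\<close>

text \<open>
  Used for \<open>g i j = x\<^sub>i x\<^sub>j\<close>, to reduce the mixed terms to power sums, and for a \<open>g\<close> that
  depends on \<open>i\<close> only, to count that each index lies in \<open>n - 1\<close> pairs.
\<close>

lemma sum_ordered_pairs: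
  fixes g :: "'n::{finite,linorder} \<Rightarrow> 'n \<Rightarrow> real"
  shows "(\<Sum>(i,j)\<in>{(i,j). i < j}. g i j + g j i) = (\<Sum>i\<in>UNIV. \<Sum>j\<in>UNIV. g i j) - (\<Sum>i\<in>UNIV. g i i)"
proof -
  have "(\<Sum>i\<in>UNIV. \<Sum>j\<in>UNIV. g i j) = (\<Sum>(i,j)\<in>UNIV. g i j)"
    by (simp add: sum.cartesian_product)
  also have "(UNIV :: ('n \<times> 'n) set) = {(i,j). i < j} \<union> {(i,j). j < i} \<union> {(i,j). i = j}"
    by auto
  also have "(\<Sum>(i,j)\<in>\<dots>. g i j) = (\<Sum>(i,j)\<in>{(i,j). i < j}. g i j)
      + (\<Sum>(i,j)\<in>{(i,j). j < i}. g i j) + (\<Sum>(i,j)\<in>{(i,j). i = j}. g i j)"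
  proof -
    have "({(i,j). i < j} \<union> {(i,j). j < i}) \<inter> {(i,j). i = j} = ({} :: ('n \<times> 'n) set)"
      and "{(i,j). i < j} \<inter> {(i,j). j < i} = ({} :: ('n \<times> 'n) set)"
      by auto
    then show ?thesis by (simp add: sum.union_disjoint)
  qed
  also have "(\<Sum>(i,j)\<in>{(i,j). j < i}. g i j) = (\<Sum>(i,j)\<in>{(i,j). i < j}. g j i)"
    by (rule sum.reindex_bij_witness[of _ prod.swap prod.swap]) auto
  also have "(\<Sum>(i,j)\<in>{(i,j). i = j}. g i j) = (\<Sum>i\<in>UNIV. g i i)"
    by (rule sum.reindex_bij_witness[of _ "\<lambda>i. (i, i)" fst]) auto
  also have "(\<Sum>(i,j)\<in>{(i,j). i < j}. g i j) + (\<Sum>(i,j)\<in>{(i,j). i < j}. g j i)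
      = (\<Sum>(i,j)\<in>{(i,j). i < j}. g i j + g j i)"
    unfolding sum.distrib[symmetric] by (intro sum.cong) auto
  finally show ?thesis by simp
qed

definition symmetric_quadratic :: "real \<Rightarrow> real \<Rightarrow> real ^ 'n::{finite,linorder} \<Rightarrow> real" where
  "symmetric_quadratic a b x =
     (\<Sum>i\<in>UNIV. (x $ i)\<^sup>2) + a * (\<Sum>i\<in>UNIV. x $ i) + b * (\<Sum>(i,j)\<in>{(i,j). i < j}. x $ i * x $ j)"

lemma symmetric_quadratic_power_sums:
  "symmetric_quadratic a b x = (1 - b / 2) * (\<Sum>i\<in>UNIV. (x $ i)\<^sup>2) + a * (\<Sum>i\<in>UNIV. x $ i)
     + b / 2 * (\<Sum>i\<in>UNIV. x $ i)\<^sup>2"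
proof -
  have "2 * (\<Sum>(i,j)\<in>{(i,j). i < j}. x $ i * x $ j)
      = (\<Sum>(i,j)\<in>{(i,j). i < j}. x $ i * x $ j + x $ j * x $ i)"
    unfolding sum_distrib_left by (intro sum.cong) auto
  also have "\<dots> = (\<Sum>i\<in>UNIV. \<Sum>j\<in>UNIV. x $ i * x $ j) - (\<Sum>i\<in>UNIV. x $ i * x $ i)"
    by (rule sum_ordered_pairs)
  also have "(\<Sum>i\<in>UNIV. \<Sum>j\<in>UNIV. x $ i * x $ j) = (\<Sum>i\<in>UNIV. x $ i)\<^sup>2"
    unfolding power2_eq_square sum_product ..
  finally have "(\<Sum>(i,j)\<in>{(i,j). i < j}. x $ i * x $ j)
      = ((\<Sum>i\<in>UNIV. x $ i)\<^sup>2 - (\<Sum>i\<in>UNIV. (x $ i)\<^sup>2)) / 2"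
    by (simp add: power2_eq_square)
  then show ?thesis
    unfolding symmetric_quadratic_def by (simp only:) (simp add: field_simps)
qed

lemma symmetric_quadratic_diagonal:
  fixes t :: real
  assumes "n = CARD('n::{finite,linorder})"
  shows "symmetric_quadratic a b (\<chi> i::'n. t) = n * (2 + b * (real n - 1)) / 2 * t\<^sup>2 + n * a * t"
  unfolding symmetric_quadratic_power_sums
  by (simp add: assms field_simps power2_eq_square)

lemma symmetric_quadratic_antidiagonal:
  assumes "i \<noteq> j"
  shows "symmetric_quadratic a b (\<chi> k. if k = i then t else if k = j then - t else 0) = (2 - b) * t\<^sup>2"
proof -
  let ?x = "\<chi> k. if k = i then t else if k = j then - t else 0"
  have "(\<Sum>k\<in>UNIV. ?x $ k) = (\<Sum>k\<in>UNIV. (if k = i then t else 0) + (if k = j then - t else 0))"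
    using assms by (intro sum.cong) auto
  moreover have "(\<Sum>k\<in>UNIV. (?x $ k)\<^sup>2) = (\<Sum>k\<in>UNIV. (if k = i then t\<^sup>2 else 0) + (if k = j then t\<^sup>2 else 0))"
    using assms by (intro sum.cong) auto
  ultimately show ?thesis
    unfolding symmetric_quadratic_power_sums by (simp add: sum.distrib algebra_simps)
qed

lemma quadratic_unbounded_below:
  fixes p q M :: real
  assumes "p < 0 \<or> p = 0 \<and> q \<noteq> 0"
  obtains t where "p * t\<^sup>2 + q * t < M"
proof (cases "p = 0")
  case True
  then show thesis using assms that[of "(M - 1) / q"] by simp
next
  case False
  with assms have p: "p < 0" by simp
  \<comment> \<open>For such \<open>t\<close>, \<open>p t + \<bar>q\<bar> < - \<bar>M\<bar>\<close>, and multiplying by \<open>t \<ge> 1\<close> preserves this.\<close>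
  define t where "t = max 1 ((\<bar>q\<bar> + \<bar>M\<bar> + 1) / - p)"
  have t: "t \<ge> 1" by (simp add: t_def)
  have "(\<bar>q\<bar> + \<bar>M\<bar> + 1) / - p \<le> t" by (simp add: t_def)
  then have "p * t + \<bar>q\<bar> \<le> - (\<bar>M\<bar> + 1)" using p by (simp add: field_simps)
  then have "t * (p * t + \<bar>q\<bar>) \<le> t * - (\<bar>M\<bar> + 1)"
    using t by (intro mult_left_mono) auto
  also have "\<dots> \<le> 1 * - (\<bar>M\<bar> + 1)"
    by (rule mult_right_mono_neg) (use t in auto)
  finally have "t * (p * t + \<bar>q\<bar>) \<le> - (\<bar>M\<bar> + 1)" by simp
  moreover have "q * t \<le> \<bar>q\<bar> * t" using t by (intro mult_right_mono) auto
  then have "p * t\<^sup>2 + q * t \<le> t * (p * t + \<bar>q\<bar>)"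
    by (simp add: power2_eq_square algebra_simps)
  ultimately show thesis using that[of t] by linarith
qed

lemma INF_eq_MInf_along_curve:
  fixes g :: "'a \<Rightarrow> real"
  assumes "\<And>t. g (\<gamma> t) = p * t\<^sup>2 + q * t" "p < 0 \<or> p = 0 \<and> q \<noteq> 0"
  shows "(INF x. ereal (g x)) = -\<infinity>"
proof (rule ereal_bot)
  fix M
  obtain t where "p * t\<^sup>2 + q * t < M"
    using quadratic_unbounded_below[OF assms(2)] .
  then show "(INF x. ereal (g x)) \<le> ereal M"
    by (intro INF_lower2[of "\<gamma> t"]) (auto simp: assms(1))
qed

lemma ereal_neg_divide_zero: "x < 0 \<Longrightarrow> ereal x / ereal 0 = -\<infinity>"
  by (simp add: divide_ereal_def)

text \<open>
  The antidiagonal direction destroys boundedness when \<open>b > 2\<close>, the diagonal one when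
  \<open>2 + b (n - 1) < 0\<close>.
\<close>

lemma INF_symmetric_quadratic_unbounded:
  assumes n: "n = CARD('n::{finite,linorder})" "n \<ge> 2" and b: "b > 2 \<or> b < -2 / (real n - 1)"
  shows "(INF x::(real, 'n) vec. ereal (symmetric_quadratic a b x)) = -\<infinity>"
proof (cases "b > 2")
  case True
  obtain i j :: 'n where "i \<noteq> j"
    using n by (metis card_2_iff' ex_card)
  then show ?thesis
    using True by (intro INF_eq_MInf_along_curve[where p = "2 - b" and q = 0
          and \<gamma> = "\<lambda>t. \<chi> k. if k = i then t else if k = j then - t else 0"])
      (auto simp: symmetric_quadratic_antidiagonal)
next
  case False
  with b n have "2 + b * (real n - 1) < 0" by (simp add: field_simps)
  then show ?thesis
    using n by (intro INF_eq_MInf_along_curve[where \<gamma> = "\<lambda>t. \<chi> i. t", OF symmetric_quadratic_diagonal[OF n(1)]])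
      (auto simp: mult_pos_neg divide_neg_pos)
qed

text \<open>
  Splitting off the multiple \<open>1 - b / 2\<close> of the Cauchy-Schwarz defect \<open>S - s\<^sup>2 / n\<close> leaves a
  quadratic in \<open>s\<close> with leading coefficient \<open>D / (2 n)\<close>, where \<open>D = 2 + b (n - 1)\<close>. The minimum
  is attained on the diagonal, where the defect vanishes. At the endpoint \<open>D = 0\<close> the
  quadratic is the linear function \<open>a s\<close>, in agreement with the values of division by zero.
\<close>

lemma INF_symmetric_quadratic:
  assumes n: "n = CARD('n::{finite,linorder})" "n \<ge> 2" and b: "-2 / (real n - 1) \<le> b" "b \<le> 2"
  shows "(INF x::(real, 'n) vec. ereal (symmetric_quadratic a b x))
    = ereal (- (a\<^sup>2) * real n) / ereal (4 + 2 * b * (real n - 1))"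
proof -
  define D where "D = 2 + b * (real n - 1)"
  have den: "4 + 2 * b * (real n - 1) = 2 * D" by (simp add: D_def algebra_simps)
  have D: "D \<ge> 0" using b(1) n by (simp add: D_def field_simps)
  have npos: "real n > 0" using n by simp
  show ?thesis
  proof (cases "D = 0 \<and> a \<noteq> 0")
    case True
    then have "(INF x::(real, 'n) vec. ereal (symmetric_quadratic a b x)) = -\<infinity>"
      using n by (intro INF_eq_MInf_along_curve[where \<gamma> = "\<lambda>t. \<chi> i. t", OF symmetric_quadratic_diagonal[OF n(1)]])
        (auto simp: D_def)
    moreover have "ereal (- (a\<^sup>2) * real n) / ereal (2 * D) = -\<infinity>"
      using True npos by (simp only: ereal_neg_divide_zero mult_neg_pos neg_less_0_iff_less zero_less_power2 mult_zero_right simp_thms)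
    ultimately show ?thesis unfolding den by simp
  next
    case False
    \<comment> \<open>If \<open>D = 0\<close>, then \<open>a = 0\<close> and both quotients below are \<open>0\<close> by convention.\<close>
    define m where "m = - (a\<^sup>2) * n / (2 * D)"
    have lower: "m \<le> symmetric_quadratic a b x" for x :: "(real, 'n) vec"
    proof -
      define s where "s = (\<Sum>i\<in>UNIV. x $ i)"
      define S where "S = (\<Sum>i\<in>UNIV. (x $ i)\<^sup>2)"
      have "s\<^sup>2 \<le> S * n"
        unfolding s_def S_def n(1) using sum_squared_le_sum_of_squares[of "\<lambda>i. x $ i" UNIV] by simp
      then have "(1 - b / 2) * (S - s\<^sup>2 / n) \<ge> 0"
        using b(2) npos by (intro mult_nonneg_nonneg) (auto simp: field_simps)
      moreover have "m \<le> D / (2 * n) * s\<^sup>2 + a * s"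
      proof (cases "D = 0")
        case True
        then show ?thesis using False by (simp add: m_def)
      next
        case D0: False
        have "D / (2 * n) * s\<^sup>2 + a * s - m = (D * s + a * n)\<^sup>2 / (2 * n * D)"
          using D0 npos unfolding m_def by (simp add: field_simps power2_eq_square)
        also have "\<dots> \<ge> 0" using D by simp
        finally show ?thesis by simp
      qed
      moreover have "symmetric_quadratic a b x = (1 - b / 2) * (S - s\<^sup>2 / n) + (D / (2 * n) * s\<^sup>2 + a * s)"
        unfolding symmetric_quadratic_power_sums s_def[symmetric] S_def[symmetric] D_def
        using npos by (simp add: field_simps)
      ultimately show ?thesis by simp
    qed
    have attained: "symmetric_quadratic a b (\<chi> i::'n. - a / D) = m"
      unfolding symmetric_quadratic_diagonal[OF n(1)] D_def[symmetric] m_def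
      by (cases "D = 0") (simp_all add: field_simps power2_eq_square)
    have "(INF x::(real, 'n) vec. ereal (symmetric_quadratic a b x)) = ereal m"
    proof (rule antisym)
      show "(INF x::(real, 'n) vec. ereal (symmetric_quadratic a b x)) \<le> ereal m"
        by (rule INF_lower2[of "\<chi> i. - a / D"]) (use attained in auto)
      show "ereal m \<le> (INF x::(real, 'n) vec. ereal (symmetric_quadratic a b x))"
        by (rule INF_greatest) (simp add: lower)
    qed
    moreover have "ereal m = ereal (- (a\<^sup>2) * real n) / ereal (2 * D)"
      using False by (cases "D = 0") (simp_all add: m_def)
    ultimately show ?thesis unfolding den by simp
  qed
qed

section \<open>The polynomial and its SONC bound\<close>

text \<open>Keeps the unit exponent vectors in the form \<open>axis i 1\<close> during simplification.\<close>

declare One_nat_def [simp del]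

lemma unit_add_unit_eq_iff:
  "axis i 1 + axis j 1 = axis k 1 + (axis l 1 :: nat ^ 'n) \<longleftrightarrow> i = k \<and> j = l \<or> i = l \<and> j = k"
proof
  assume eq: "axis i 1 + axis j 1 = axis k 1 + (axis l 1 :: nat ^ 'n)"
  have "(axis i 1 + axis j 1 :: nat ^ 'n) $ m = (axis k 1 + axis l 1) $ m" for m
    using eq by simp
  from this[of i] this[of j] this[of k] this[of l]
  show "i = k \<and> j = l \<or> i = l \<and> j = k"
    by (auto simp: axis_def split: if_splits)
qed (auto simp: add.commute)

lemma unit_add_unit_neq_unit: "axis i 1 + axis j 1 \<noteq> (axis k 1 :: nat ^ 'n)"
proof
  assume eq: "axis i 1 + axis j 1 = (axis k 1 :: nat ^ 'n)"
  have "(axis i 1 + axis j 1 :: nat ^ 'n) $ m = axis k 1 $ m" for m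
    using eq by simp
  from this[of i] this[of j] show False
    by (auto simp: axis_def split: if_splits)
qed

lemma unit_eq_iff: "axis i 1 = (axis k 1 :: nat ^ 'n) \<longleftrightarrow> i = k"
  by (simp add: axis_eq_axis)

lemma unit_add_unit_not_even: "i \<noteq> j \<Longrightarrow> axis i 1 + (axis j 1 :: nat ^ 'n) \<notin> even_exponents"
  by (auto simp: even_exponents_def axis_def intro!: exI[of _ i])

definition symmetric_poly :: "real \<Rightarrow> real \<Rightarrow> 'n::{finite,linorder} mpoly" where
  "symmetric_poly a b = (\<Sum>i\<in>UNIV. mpoly_var i ^ 2)
        + mpoly_const a * (\<Sum>i\<in>UNIV. mpoly_var i)
        + mpoly_const b * (\<Sum>(i,j)\<in>{(i,j). i < j}. mpoly_var i * mpoly_var j)"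

lemma weighted_eval_symmetric_poly:
  "weighted_eval w (symmetric_poly a b :: 'n::{finite,linorder} mpoly) =
     (\<Sum>i\<in>UNIV. w (axis i 1 + axis i 1)) + a * (\<Sum>i\<in>UNIV. w (axis i 1))
     + b * (\<Sum>(i,j)\<in>{(i,j). i < j}. w (axis i 1 + axis j 1))"
proof -
  have "symmetric_poly a b = (\<Sum>i\<in>UNIV. Poly_Mapping.single (axis i 1 + axis i 1) 1)
      + (\<Sum>i\<in>UNIV. Poly_Mapping.single (axis i 1) a)
      + (\<Sum>(i,j)\<in>{(i,j). i < j}. Poly_Mapping.single (axis i 1 + axis j 1 :: (nat, 'n) vec) b)"
    unfolding symmetric_poly_def mpoly_var_def mpoly_const_def power2_eq_square
    by (simp add: sum_distrib_left mult_single case_prod_beta)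
  then show ?thesis
    by (simp add: sum_distrib_left case_prod_beta)
qed

lemma mpoly_eval_symmetric_poly: "mpoly_eval (symmetric_poly a b) x = symmetric_quadratic a b x"
  unfolding mpoly_eval_eq_weighted_eval weighted_eval_symmetric_poly symmetric_quadratic_def
  by (simp add: monom_val_add monom_val_unit power2_eq_square)

text \<open>
  The exponents that the squares of the decomposition need must occur in the polynomial.
  The distinctness of the exponents excludes cancellation between the three sums.
\<close>

lemma support_symmetric_poly:
  fixes a b :: real
  defines "K \<equiv> Poly_Mapping.keys (symmetric_poly a b :: 'n::{finite,linorder} mpoly)"
  shows "axis k 1 + axis k 1 \<in> K" and "a \<noteq> 0 \<Longrightarrow> axis k 1 \<in> K"
    and "b \<noteq> 0 \<Longrightarrow> k < l \<Longrightarrow> axis k 1 + axis l 1 \<in> K"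
proof -
  note [simp] = in_keys_iff lookup_eq_weighted_eval weighted_eval_symmetric_poly
    unit_eq_iff unit_add_unit_eq_iff unit_add_unit_neq_unit unit_add_unit_neq_unit[symmetric]
  show "axis k 1 + axis k 1 \<in> K"
    unfolding K_def by (simp, subst sum.neutral) auto
  show "axis k 1 \<in> K" if "a \<noteq> 0"
    unfolding K_def using that by simp
  show "axis k 1 + axis l 1 \<in> K" if "b \<noteq> 0" "k < l"
  proof -
    have "(\<Sum>(i,j)\<in>{(i,j). i < j}. if i = k \<and> j = l \<or> i = l \<and> j = k then 1 else 0 :: real)
        = (\<Sum>p\<in>{(i,j). i < j}. if p = (k, l) then 1 else 0)"
      using that by (intro sum.cong) (auto split: if_splits)
    also have "\<dots> = 1" using that by simp
    finally have "(\<Sum>(i,j)\<in>{(i,j). i < j}. if i = k \<and> j = l \<or> i = l \<and> j = k then 1 else 0 :: real) = 1" .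
    moreover have "(\<Sum>i\<in>UNIV. if i = k \<and> i = l \<or> i = l \<and> i = k then 1 else 0 :: real) = 0"
      using that by (intro sum.neutral) auto
    ultimately show ?thesis
      unfolding K_def using that by simp
  qed
qed

text \<open>
  For \<open>b > 0\<close> the sign pattern is \<open>-1\<close> exactly on the odd exponents other than the unit
  vectors; so among the monomials of the polynomial it flips the products \<open>x\<^sub>i x\<^sub>j\<close>. For
  \<open>b \<le> 0\<close> the trivial pattern suffices.
\<close>

lemma SONC_bound_le_sign_flipped:
  fixes a b l :: real and x :: "(real, 'n::{finite,linorder}) vec"
  defines "f \<equiv> symmetric_poly a b :: 'n mpoly"
  assumes "f - mpoly_const l \<in> C_SONC (insert 0 (Poly_Mapping.keys f))"
  shows "l \<le> symmetric_quadratic a (- \<bar>b\<bar>) x"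
proof -
  define \<epsilon> :: "(nat, 'n) vec \<Rightarrow> real" where
    "\<epsilon> \<alpha> = (if b \<le> 0 \<or> \<alpha> \<in> even_exponents \<or> \<alpha> \<in> range (\<lambda>i. axis i 1) then 1 else -1)" for \<alpha>
  have "weighted_eval (\<lambda>\<alpha>. \<epsilon> \<alpha> * monom_val \<alpha> x) (f - mpoly_const l) \<ge> 0"
    by (rule C_SONC_sign_twist_nonneg[OF _ assms(2)]) (auto simp: \<epsilon>_def)
  moreover have "0 \<in> (even_exponents :: (nat, 'n) vec set)"
    by (simp add: even_exponents_def)
  moreover have "(\<Sum>(i,j)\<in>{(i,j). i < j}. \<epsilon> (axis i 1 + axis j 1) * monom_val (axis i 1 + axis j 1) x)
      = (\<Sum>(i,j)\<in>{(i,j). i < j}. (if b \<le> 0 then 1 else -1) * (x $ i * x $ j))"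
    by (intro sum.cong)
      (auto simp: \<epsilon>_def monom_val_add monom_val_unit unit_add_unit_not_even unit_add_unit_neq_unit)
  moreover have "b * (\<Sum>(i,j)\<in>{(i,j). i < j}. (if b \<le> 0 then 1 else -1) * (x $ i * x $ j))
      = - \<bar>b\<bar> * (\<Sum>(i,j)\<in>{(i,j). i < j}. x $ i * x $ j)"
    by (simp add: sum_negf case_prod_beta)
  ultimately show ?thesis
    by (simp add: f_def mpoly_const_def weighted_eval_symmetric_poly symmetric_quadratic_def
        \<epsilon>_def monom_val_add monom_val_unit double_in_even_exponents power2_eq_square)
qed

text \<open>
  The square terms are distributed: each pair uses \<open>\<bar>b\<bar> / 2\<close> of the squares of its two
  variables, which takes \<open>\<bar>b\<bar> (n - 1) / 2\<close> from each square. The rest \<open>c\<close> completes the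
  square with the linear term, at the cost of a constant \<open>d\<close> per variable. Stating this with
  \<open>a\<^sup>2 \<le> 4 c d\<close> in place of \<open>d = a\<^sup>2 / (4 c)\<close> includes the case \<open>a = c = 0\<close>.
\<close>

lemma symmetric_poly_minus_const_in_C_SONC:
  fixes a b c d :: real and n :: nat
  defines "T \<equiv> insert 0 (Poly_Mapping.keys (symmetric_poly a b :: 'n::{finite,linorder} mpoly))"
  assumes n: "n = CARD('n)"
    and c: "2 * c = 2 - \<bar>b\<bar> * (real n - 1)" "c \<ge> 0" and d: "d \<ge> 0" "a\<^sup>2 \<le> 4 * c * d"
  shows "symmetric_poly a b - mpoly_const (- n * d) \<in> C_SONC T"
proof -
  let ?e = "\<lambda>i. axis i 1 :: (nat, 'n) vec"
  define p where "p i = Poly_Mapping.single (?e i + ?e i) c + Poly_Mapping.single (0 + 0) d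
    + Poly_Mapping.single (?e i + 0) a" for i
  define q where "q i j = Poly_Mapping.single (?e i + ?e i) (\<bar>b\<bar> / 2)
    + Poly_Mapping.single (?e j + ?e j) (\<bar>b\<bar> / 2) + Poly_Mapping.single (?e i + ?e j) b" for i j
  have T: "finite T" "0 \<in> T"
    by (simp_all add: T_def)
  have supp: "?e i + ?e i \<in> T" "a \<noteq> 0 \<Longrightarrow> ?e i \<in> T" "b \<noteq> 0 \<Longrightarrow> i < j \<Longrightarrow> ?e i + ?e j \<in> T" for i j
    unfolding T_def using support_symmetric_poly[where a = a and b = b] by blast+
  have "p i \<in> C_SONC T" for i
    unfolding p_def using c d T supp by (intro square_in_C_SONC) auto
  moreover have "q i j \<in> C_SONC T" if "i < j" for i j
    unfolding q_def using T supp that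
    by (intro square_in_C_SONC) (auto simp: unit_eq_iff power2_eq_square)
  ultimately have "(\<Sum>i\<in>UNIV. p i) + (\<Sum>(i,j)\<in>{(i,j). i < j}. q i j) \<in> C_SONC T"
    using T by (intro C_SONC_add C_SONC_sum) auto
  moreover have "symmetric_poly a b - mpoly_const (- n * d)
      = (\<Sum>i\<in>UNIV. p i) + (\<Sum>(i,j)\<in>{(i,j). i < j}. q i j)"
  proof (rule poly_mapping_eqI_weighted_eval)
    fix w :: "(nat, 'n) vec \<Rightarrow> real"
    define W V U where "W = (\<Sum>i\<in>UNIV. w (?e i + ?e i))" and "V = (\<Sum>i\<in>UNIV. w (?e i))"
      and "U = (\<Sum>(i,j)\<in>{(i,j). i < j}. w (?e i + ?e j))"
    have "(\<Sum>(i,j)\<in>{(i,j). i < j}. weighted_eval w (q i j))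
        = (\<Sum>(i,j)\<in>{(i,j). i < j}. \<bar>b\<bar> / 2 * (w (?e i + ?e i) + w (?e j + ?e j)) + b * w (?e i + ?e j))"
      unfolding q_def by (simp add: algebra_simps)
    also have "\<dots> = \<bar>b\<bar> / 2 * (\<Sum>(i,j)\<in>{(i,j). i < j}. w (?e i + ?e i) + w (?e j + ?e j)) + b * U"
      unfolding U_def
      by (simp add: sum.distrib case_prod_beta flip: sum_distrib_left sum_divide_distrib)
    also have "(\<Sum>(i,j)\<in>{(i,j). i < j}. w (?e i + ?e i) + w (?e j + ?e j)) = (real n - 1) * W"
      unfolding sum_ordered_pairs W_def n by (simp add: sum_distrib_left[symmetric] algebra_simps)
    also have "\<bar>b\<bar> / 2 * ((real n - 1) * W) = (1 - c) * W"
    proof -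
      have "1 - c = \<bar>b\<bar> / 2 * (real n - 1)" using c(1) by (simp add: field_simps)
      then show ?thesis by simp
    qed
    finally have q: "(\<Sum>(i,j)\<in>{(i,j). i < j}. weighted_eval w (q i j)) = (1 - c) * W + b * U" .
    have p: "(\<Sum>i\<in>UNIV. weighted_eval w (p i)) = c * W + n * d * w 0 + a * V"
      unfolding p_def W_def V_def n by (simp add: sum.distrib sum_distrib_left)
    have U: "(\<Sum>p\<in>{(i,j). i < j}. w (?e (fst p) + ?e (snd p))) = U"
      by (simp add: U_def case_prod_beta)
    show "weighted_eval w (symmetric_poly a b - mpoly_const (- n * d))
        = weighted_eval w ((\<Sum>i\<in>UNIV. p i) + (\<Sum>(i,j)\<in>{(i,j). i < j}. q i j))"
      using p q U by (simp add: weighted_eval_symmetric_poly mpoly_const_def case_prod_beta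
          W_def[symmetric] V_def[symmetric] algebra_simps)
  qed
  ultimately show ?thesis by simp
qed

text \<open>
  The explicit decomposition shows that the upper bound is attained whenever the infimum on
  the right-hand side is finite; otherwise that infimum is \<open>-\<infinity>\<close> and nothing needs
  to be attained.
\<close>

lemma poly_SONC_symmetric_poly:
  assumes n: "n = CARD('n::{finite,linorder})" "n \<ge> 2"
  shows "poly_SONC (symmetric_poly a b :: 'n mpoly)
    = (INF x::(real, 'n) vec. ereal (symmetric_quadratic a (- \<bar>b\<bar>) x))" (is "?S = ?I")
proof (rule antisym)
  show "?S \<le> ?I"
    unfolding poly_SONC_def
    by (intro Sup_least INF_greatest) (auto intro: SONC_bound_le_sign_flipped)
  define c where "c = 1 - \<bar>b\<bar> * (real n - 1) / 2"
  have c2: "2 * c = 2 - \<bar>b\<bar> * (real n - 1)" by (simp add: c_def)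
  show "?I \<le> ?S"
  proof (cases "c < 0")
    case True
    then have "- \<bar>b\<bar> < -2 / (real n - 1)"
      using n by (simp add: c_def field_simps)
    then show ?thesis by (simp add: INF_symmetric_quadratic_unbounded[OF n])
  next
    case False
    then have "-2 / (real n - 1) \<le> - \<bar>b\<bar>"
      using n by (simp add: c_def field_simps)
    moreover have den: "4 + 2 * (- \<bar>b\<bar>) * (real n - 1) = 4 * c"
      by (simp add: c_def field_simps)
    ultimately have I: "?I = ereal (- (a\<^sup>2) * real n) / ereal (4 * c)"
      using INF_symmetric_quadratic[OF n, of "- \<bar>b\<bar>" a] by simp
    show ?thesis
    proof (cases "c = 0 \<and> a \<noteq> 0")
      case True
      then show ?thesis
        unfolding I using n(2) by (simp add: ereal_neg_divide_zero mult_neg_pos del: ereal_divide)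
    next
      case ca: False
      define d where "d = a\<^sup>2 / (4 * c)"
      have "symmetric_poly a b - mpoly_const (- n * d)
          \<in> C_SONC (insert 0 (Poly_Mapping.keys (symmetric_poly a b :: 'n mpoly)))"
        using False ca by (intro symmetric_poly_minus_const_in_C_SONC[OF n(1) c2]) (auto simp: d_def)
      then have "ereal (- n * d) \<le> ?S"
        unfolding poly_SONC_def by (intro Sup_upper imageI CollectI)
      moreover have "?I = ereal (- n * d)"
        unfolding I d_def using ca by (cases "c = 0") auto
      ultimately show ?thesis by simp
    qed
  qed
qed

theorem proposition4p6:
  fixes f :: "'n::{finite,linorder} mpoly" and a b :: real and n :: nat
  assumes n_def: "n = CARD('n)" and n_ge: "n \<ge> 2"
    and f_def: "f = (\<Sum>i\<in>UNIV. mpoly_var i ^ 2)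
        + mpoly_const a * (\<Sum>i\<in>UNIV. mpoly_var i)
        + mpoly_const b * (\<Sum>(i,j)\<in>{(i,j). i < j}. mpoly_var i * mpoly_var j)"
  shows "(b > 2 \<or> b < -2 / (real n - 1) \<longrightarrow>
            poly_inf f = -\<infinity> \<and> poly_SONC f = -\<infinity>)
    \<and> (-2 / (real n - 1) \<le> b \<and> b \<le> 0 \<longrightarrow>
            poly_inf f = ereal (- (a^2) * real n) / ereal (4 + 2 * b * (real n - 1))
          \<and> poly_SONC f = ereal (- (a^2) * real n) / ereal (4 + 2 * b * (real n - 1)))
    \<and> (0 \<le> b \<and> b \<le> 2 / (real n - 1) \<longrightarrow>
            poly_inf f = ereal (- (a^2) * real n) / ereal (4 + 2 * b * (real n - 1))
          \<and> poly_SONC f = ereal (- (a^2) * real n) / ereal (4 - 2 * b * (real n - 1)))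
    \<and> (2 / (real n - 1) < b \<and> b \<le> 2 \<longrightarrow>
            poly_inf f = ereal (- (a^2) * real n) / ereal (4 + 2 * b * (real n - 1))
          \<and> poly_SONC f = -\<infinity>)"
proof -
  note n = n_def n_ge
  have f: "f = symmetric_poly a b"
    by (simp add: f_def symmetric_poly_def)
  have inf: "poly_inf f = (INF x::(real, 'n) vec. ereal (symmetric_quadratic a b x))"
    by (simp add: f poly_inf_def mpoly_eval_symmetric_poly)
  have SONC: "poly_SONC f = (INF x::(real, 'n) vec. ereal (symmetric_quadratic a (- \<bar>b\<bar>) x))"
    by (simp add: f poly_SONC_symmetric_poly[OF n])
  have bounds: "0 < 2 / (real n - 1)" "2 / (real n - 1) \<le> 2"
    using n_ge by (auto simp: field_simps)
  note unbounded = INF_symmetric_quadratic_unbounded[OF n] and bounded = INF_symmetric_quadratic[OF n]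
  show ?thesis
  proof (intro conjI impI; (elim conjE)?)
    assume "b > 2 \<or> b < -2 / (real n - 1)"
    then show "poly_inf f = -\<infinity>" "poly_SONC f = -\<infinity>"
      using bounds unfolding inf SONC by (auto intro!: unbounded)
  next
    assume b: "-2 / (real n - 1) \<le> b" "b \<le> 0"
    then have abs: "- \<bar>b\<bar> = b" by simp
    show "poly_inf f = ereal (- (a^2) * real n) / ereal (4 + 2 * b * (real n - 1))"
      and "poly_SONC f = ereal (- (a^2) * real n) / ereal (4 + 2 * b * (real n - 1))"
      unfolding inf SONC abs by (rule bounded; use b in simp)+
  next
    assume b: "0 \<le> b" "b \<le> 2 / (real n - 1)"
    then have abs: "- \<bar>b\<bar> = - b" by simp
    have minus: "4 - 2 * b * (real n - 1) = 4 + 2 * (- b) * (real n - 1)" by simp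
    have lo: "-2 / (real n - 1) \<le> b" "-2 / (real n - 1) \<le> - b" and hi: "b \<le> 2" "- b \<le> 2"
      using b bounds by auto
    show "poly_inf f = ereal (- (a^2) * real n) / ereal (4 + 2 * b * (real n - 1))"
      unfolding inf by (rule bounded[OF lo(1) hi(1)])
    show "poly_SONC f = ereal (- (a^2) * real n) / ereal (4 - 2 * b * (real n - 1))"
      unfolding SONC abs minus by (rule bounded[OF lo(2) hi(2)])
  next
    assume b: "2 / (real n - 1) < b" "b \<le> 2"
    then have lo: "-2 / (real n - 1) \<le> b" and neg: "- \<bar>b\<bar> < -2 / (real n - 1)"
      using bounds unfolding minus_divide_left[symmetric] by linarith+
    show "poly_inf f = ereal (- (a^2) * real n) / ereal (4 + 2 * b * (real n - 1))"
      unfolding inf by (rule bounded[OF lo b(2)])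
    show "poly_SONC f = -\<infinity>"
      unfolding SONC using neg by (intro unbounded) simp
  qed
qed

end
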